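(* Let $R$ be a ring. Then: (1) $R$ is a $2$-primal ring if and only if $QN(R[x])=N_{\ast}(R)[x]$. (2) $R$ is a reduced ring if and only if $QN(R[x])=\{0\}$.
   Context: Rings are associative with identity, not necessarily commutative; $R[x]$ is the polynomial ring in an indeterminate $x$ commuting with the elements of $R$. For a ring $S$, an element $a\in S$ is quasinilpotent if $1-as$ is a unit of $S$ for every $s\in S$ with $as=sa$; $QN(S)$ is the set of quasinilpotent elements of $S$. $N(R)$ is the set of nilpotent elements of $R$ and $N_{\ast}(R)$ is the lower nilradical (prime radical) of $R$, the intersection of all prime ideals. $N_{\ast}(R)[x]$ is the set of polynomials with all coefficients in $N_{\ast}(R)$. $R$ is $2$-primal if $N(R)=N_{\ast}(R)$, and reduced if $N(R)=\{0\}$. *)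

theory Defs
  imports "HOL-Algebra.UnivPoly" "HOL-Algebra.Ideal_Product"
begin

definition quasinilpotent_elements :: "('a, 'b) ring_scheme \<Rightarrow> 'a set" where
  "quasinilpotent_elements S =
     {a \<in> carrier S. \<forall>s \<in> carrier S. a \<otimes>\<^bsub>S\<^esub> s = s \<otimes>\<^bsub>S\<^esub> a \<longrightarrow>
        \<one>\<^bsub>S\<^esub> \<ominus>\<^bsub>S\<^esub> a \<otimes>\<^bsub>S\<^esub> s \<in> Units S}"

definition nilpotent_elements :: "('a, 'b) ring_scheme \<Rightarrow> 'a set" where
  "nilpotent_elements R =
     {a \<in> carrier R. \<exists>n::nat. n > 0 \<and> a [^]\<^bsub>R\<^esub> n = \<zero>\<^bsub>R\<^esub>}"

text \<open>
  The library locale \<^locale>\<open>primeideal\<close> is restricted to commutative rings and to the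
  elementwise (completely prime) condition. The notion for arbitrary rings is the one
  formulated with products of two-sided ideals.
\<close>

definition prime_ideal :: "'a set \<Rightarrow> ('a, 'b) ring_scheme \<Rightarrow> bool" where
  "prime_ideal P R \<longleftrightarrow> ideal P R \<and> P \<noteq> carrier R \<and>
     (\<forall>I J. ideal I R \<and> ideal J R \<and> ideal_prod R I J \<subseteq> P \<longrightarrow> I \<subseteq> P \<or> J \<subseteq> P)"

text \<open>
  The intersection is taken inside the carrier, so that the zero ring, which has no prime
  ideals, is its own lower nilradical.
\<close>

definition lower_nilradical :: "('a, 'b) ring_scheme \<Rightarrow> 'a set" where
  "lower_nilradical R = {a \<in> carrier R. \<forall>P. prime_ideal P R \<longrightarrow> a \<in> P}"

definition two_primal :: "('a, 'b) ring_scheme \<Rightarrow> bool" where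
  "two_primal R \<longleftrightarrow> nilpotent_elements R = lower_nilradical R"

definition reduced_ring :: "('a, 'b) ring_scheme \<Rightarrow> bool" where
  "reduced_ring R \<longleftrightarrow> nilpotent_elements R = {\<zero>\<^bsub>R\<^esub>}"

definition polys_with_coeffs_in :: "'a set \<Rightarrow> ('a, 'b) ring_scheme \<Rightarrow> (nat \<Rightarrow> 'a) set" where
  "polys_with_coeffs_in A R =
     {p \<in> carrier (UP R). \<forall>i. coeff (UP R) p i \<in> A}"

end

theory Submission
  imports Defs
begin

text \<open>
  For $f \in QN(R[x])$ the indeterminate commutes with $f$, so $1 - f x$ is a unit; when $R/N$ is
  reduced, units of $(R/N)[x]$ are constant, which forces all coefficients of $f$ into $N$.
  Conversely, a non-nilpotent element is avoided by a prime ideal, namely one maximal among the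
  ideals containing no power of it, so lower nilradicals are nil. Primes of $R[x]$ contract to
  primes of $R$, hence $N_{\ast}(R)[x] \subseteq N_{\ast}(R[x])$ is a nil ideal and therefore
  quasinilpotent.
\<close>

section \<open>Nilpotent and quasinilpotent elements, and the lower nilradical of a ring\<close>

context ring
begin

text \<open>The inverse is a finite geometric series. Induction on \<open>k\<close> builds a
  two-sided cofactor of \<open>1 - a\<close> with product \<open>1 - a^k\<close>, and at
  \<open>k = n\<close> this product is 1.\<close>

lemma one_minus_nilpotent_Units:
  assumes "a \<in> nilpotent_elements R"
  shows "\<one> \<ominus> a \<in> Units R"
proof -
  obtain n :: nat where a: "a \<in> carrier R" and n: "a [^] n = \<zero>"
    using assms unfolding nilpotent_elements_def by blast
  have "\<exists>s \<in> carrier R. (\<one> \<ominus> a) \<otimes> s = \<one> \<ominus> a [^] k \<and> s \<otimes> (\<one> \<ominus> a) = \<one> \<ominus> a [^] k" for k :: nat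
  proof (induction k)
    case 0
    show ?case using a by (intro bexI[of _ \<zero>]) (simp_all add: minus_eq r_neg)
  next
    case (Suc k)
    then obtain s where s: "s \<in> carrier R" "(\<one> \<ominus> a) \<otimes> s = \<one> \<ominus> a [^] k"
      "s \<otimes> (\<one> \<ominus> a) = \<one> \<ominus> a [^] k" by blast
    have pa: "a [^] k \<in> carrier R" using a by simp
    have tel: "(\<one> \<ominus> a) \<oplus> (a \<ominus> a [^] Suc k) = \<one> \<ominus> a [^] Suc k"
      using a by (simp add: minus_eq a_assoc r_neg1 r_neg2 del: nat_pow_Suc)
    \<comment> \<open>The next cofactor \<open>1 + s a\<close> is one Horner step of
      \<open>1 + a + ... + a^k\<close>.\<close>
    have "(\<one> \<ominus> a) \<otimes> (\<one> \<oplus> s \<otimes> a) = (\<one> \<ominus> a) \<oplus> ((\<one> \<ominus> a) \<otimes> s) \<otimes> a"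
      using a s(1) by (simp add: r_distr m_assoc)
    also have "\<dots> = \<one> \<ominus> a [^] Suc k"
      unfolding s(2) tel[symmetric] using a pa by (simp add: minus_eq l_distr l_minus)
    finally have 1: "(\<one> \<ominus> a) \<otimes> (\<one> \<oplus> s \<otimes> a) = \<one> \<ominus> a [^] Suc k" .
    \<comment> \<open>The induction hypothesis does not say that \<open>s\<close> commutes with
      \<open>a\<close>. Moving \<open>a\<close> past \<open>1 - a\<close> instead brings
      \<open>s\<close> next to \<open>1 - a\<close>.\<close>
    have "a \<otimes> (\<one> \<ominus> a) = (\<one> \<ominus> a) \<otimes> a"
      using a by (simp add: minus_eq l_distr r_distr l_minus r_minus)
    then have "(\<one> \<oplus> s \<otimes> a) \<otimes> (\<one> \<ominus> a) = (\<one> \<ominus> a) \<oplus> (s \<otimes> (\<one> \<ominus> a)) \<otimes> a"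
      using a s(1) by (simp add: l_distr m_assoc)
    also have "\<dots> = \<one> \<ominus> a [^] Suc k"
      unfolding s(3) tel[symmetric] using a pa by (simp add: minus_eq l_distr l_minus)
    finally show ?case using 1 a s(1) by (intro bexI[of _ "\<one> \<oplus> s \<otimes> a"]) simp_all
  qed
  from this[of n] obtain s where "s \<in> carrier R" "(\<one> \<ominus> a) \<otimes> s = \<one>" "s \<otimes> (\<one> \<ominus> a) = \<one>"
    unfolding n by (auto simp: minus_eq)
  then show ?thesis using a unfolding Units_def by auto
qed

lemma nilpotent_subset_quasinilpotent:
  "nilpotent_elements R \<subseteq> quasinilpotent_elements R"
proof
  fix a assume a: "a \<in> nilpotent_elements R"
  then obtain n :: nat where n: "a \<in> carrier R" "n > 0" "a [^] n = \<zero>"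
    unfolding nilpotent_elements_def by blast
  have "\<one> \<ominus> a \<otimes> s \<in> Units R" if s: "s \<in> carrier R" "a \<otimes> s = s \<otimes> a" for s
  proof (rule one_minus_nilpotent_Units)
    have "(a \<otimes> s) [^] n = \<zero>"
      using n s pow_mult_distrib[OF s(2) n(1) s(1)] by simp
    then show "a \<otimes> s \<in> nilpotent_elements R"
      using n s unfolding nilpotent_elements_def by blast
  qed
  then show "a \<in> quasinilpotent_elements R"
    using n(1) unfolding quasinilpotent_elements_def by blast
qed

lemma nil_ideal_subset_quasinilpotent:
  assumes "ideal I R" "I \<subseteq> nilpotent_elements R"
  shows "I \<subseteq> quasinilpotent_elements R"
proof -
  interpret I: ideal I R by fact
  have "\<one> \<ominus> a \<otimes> s \<in> Units R" if "a \<in> I" "s \<in> carrier R" for a s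
    using assms(2) I.I_r_closed[OF that] one_minus_nilpotent_Units by blast
  then show ?thesis unfolding quasinilpotent_elements_def using I.Icarr by blast
qed

lemma ideal_Union_chain:
  assumes "subset.chain {I. ideal I R} C" "C \<noteq> {}"
  shows "ideal (\<Union>C) R"
proof -
  have id: "ideal I R" if "I \<in> C" for I
    using assms(1) that unfolding subset.chain_def by blast
  have lin: "I \<subseteq> J \<or> J \<subseteq> I" if "I \<in> C" "J \<in> C" for I J
    using assms(1) that unfolding subset.chain_def by blast
  have sub: "subgroup I (add_monoid R)" if "I \<in> C" for I
    using id[OF that] additive_subgroup.a_subgroup ideal.axioms(1) by blast
  show ?thesis
  proof (rule idealI[OF ring_axioms])
    show "subgroup (\<Union>C) (add_monoid R)"
    proof (rule add.subgroupI)
      show "\<Union>C \<subseteq> carrier R" using ideal.Icarr[OF id] by auto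
      show "\<Union>C \<noteq> {}"
        using assms(2) subgroup.one_closed[OF sub] by auto
      show "\<ominus> a \<in> \<Union>C" if "a \<in> \<Union>C" for a
        using that subgroup.m_inv_closed[OF sub] unfolding a_inv_def by auto
      show "a \<oplus> b \<in> \<Union>C" if "a \<in> \<Union>C" "b \<in> \<Union>C" for a b
      proof -
        from that obtain I J where "I \<in> C" "a \<in> I" "J \<in> C" "b \<in> J" by blast
        with lin[of I J] obtain I where "I \<in> C" "a \<in> I" "b \<in> I" by blast
        then show ?thesis
          using subgroup.m_closed[OF sub, of I a b] by auto
      qed
    qed
    show "x \<otimes> a \<in> \<Union>C" "a \<otimes> x \<in> \<Union>C" if "a \<in> \<Union>C" "x \<in> carrier R" for a x
      using that ideal.I_l_closed[OF id] ideal.I_r_closed[OF id] by blast+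
  qed
qed

text \<open>In the expansion of \<open>(p + i)(q + j)\<close> three of the four products have a
  factor in \<open>P\<close>, and the fourth lies in \<open>I J\<close>. This is the computation
  that makes a maximal power-avoiding ideal prime.\<close>

lemma ideal_sum_prod_subset:
  assumes "ideal P R" "ideal I R" "ideal J R" "ideal_prod R I J \<subseteq> P"
    and "a \<in> set_add R P I" "b \<in> set_add R P J"
  shows "a \<otimes> b \<in> P"
proof -
  interpret P: ideal P R by fact
  interpret I: ideal I R by fact
  interpret J: ideal J R by fact
  obtain p i q j where pi: "p \<in> P" "i \<in> I" "a = p \<oplus> i" and qj: "q \<in> P" "j \<in> J" "b = q \<oplus> j"
    using assms(5,6) unfolding set_add_def' by blast
  have "i \<otimes> j \<in> P" using assms(4) ideal_prod.prod[OF pi(2) qj(2), of R] by auto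
  moreover have "a \<otimes> b = p \<otimes> (q \<oplus> j) \<oplus> (i \<otimes> q \<oplus> i \<otimes> j)"
    using pi qj P.Icarr I.Icarr J.Icarr by (simp add: l_distr r_distr a_ac)
  ultimately show ?thesis
    using pi qj P.Icarr I.Icarr J.Icarr P.I_l_closed P.I_r_closed P.a_closed by simp
qed

text \<open>Let \<open>P\<close> be maximal among the ideals without positive powers of
  \<open>a\<close>. If neither \<open>I\<close> nor \<open>J\<close> lies in \<open>P\<close>, then
  \<open>P + I\<close> and \<open>P + J\<close> contain powers \<open>a^n\<close> and
  \<open>a^m\<close>; from \<open>I J\<close> inside \<open>P\<close> it would follow that
  \<open>a^(n+m)\<close> is in \<open>P\<close>.\<close>

lemma prime_ideal_avoiding_powers:
  assumes a: "a \<in> carrier R" "a \<notin> nilpotent_elements R"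
  obtains P where "prime_ideal P R" "a \<notin> P"
proof -
  define A where "A = {I. ideal I R \<and> (\<forall>n::nat>0. a [^] n \<notin> I)}"
  \<comment> \<open>Non-nilpotency of \<open>a\<close> says exactly that the zero ideal avoids its
    positive powers, which makes \<open>A\<close> nonempty for Zorn's lemma.\<close>
  have zero: "{\<zero>} \<in> A"
    using a zeroideal unfolding A_def nilpotent_elements_def by blast
  have "\<Union>C \<in> A" if C: "C \<noteq> {}" "subset.chain A C" for C
  proof -
    have "subset.chain {I. ideal I R} C"
      using C(2) unfolding subset.chain_def A_def by blast
    moreover have "C \<subseteq> A" using C(2) unfolding subset.chain_def by blast
    ultimately show ?thesis
      using ideal_Union_chain C(1) unfolding A_def by blast
  qed
  then obtain P where P: "P \<in> A" and max: "\<And>X. X \<in> A \<Longrightarrow> P \<subseteq> X \<Longrightarrow> X = P"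
    using subset_Zorn_nonempty[of A] zero by (metis emptyE)
  have idP: "ideal P R" and pow: "\<And>n::nat. n > 0 \<Longrightarrow> a [^] n \<notin> P"
    using P unfolding A_def by auto
  interpret P: ideal P R by (rule idP)
  \<comment> \<open>Otherwise \<open>P + I\<close> would belong to \<open>A\<close> and contain
    \<open>P\<close>, hence equal \<open>P\<close> by maximality, forcing \<open>I\<close> into
    \<open>P\<close>.\<close>
  have big: "\<exists>n::nat>0. a [^] n \<in> set_add R P I" if I: "ideal I R" "\<not> I \<subseteq> P" for I
  proof (rule ccontr)
    interpret I: ideal I R by fact
    assume "\<not> ?thesis"
    then have "set_add R P I \<in> A" using add_ideals[OF idP I(1)] unfolding A_def by blast
    moreover have "P \<subseteq> set_add R P I"
    proof
      fix p assume "p \<in> P"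
      then have "p = p \<oplus> \<zero>" "\<zero> \<in> I" using P.Icarr by simp_all
      with \<open>p \<in> P\<close> show "p \<in> set_add R P I" unfolding set_add_def' by blast
    qed
    moreover have "I \<subseteq> set_add R P I"
    proof
      fix i assume "i \<in> I"
      then have "i = \<zero> \<oplus> i" "\<zero> \<in> P" using I.Icarr by simp_all
      with \<open>i \<in> I\<close> show "i \<in> set_add R P I" unfolding set_add_def' by blast
    qed
    ultimately show False using max I(2) by blast
  qed
  have "I \<subseteq> P \<or> J \<subseteq> P" if IJ: "ideal I R" "ideal J R" "ideal_prod R I J \<subseteq> P" for I J
  proof (rule ccontr)
    assume "\<not> (I \<subseteq> P \<or> J \<subseteq> P)"
    then obtain n m :: nat where "n > 0" "a [^] n \<in> set_add R P I" "m > 0" "a [^] m \<in> set_add R P J"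
      using big IJ by blast
    then have "a [^] (n + m) \<in> P"
      using ideal_sum_prod_subset[OF idP IJ] nat_pow_mult[OF a(1)] by metis
    then show False using pow[of "n + m"] \<open>n > 0\<close> by simp
  qed
  moreover have "a \<notin> P" using pow[of 1] a(1) by simp
  ultimately have "prime_ideal P R" using idP a(1) unfolding prime_ideal_def by blast
  then show thesis using \<open>a \<notin> P\<close> that by blast
qed

lemma lower_nilradical_subset_nilpotent:
  "lower_nilradical R \<subseteq> nilpotent_elements R"
  using prime_ideal_avoiding_powers unfolding lower_nilradical_def by blast

lemma ideal_lower_nilradical: "ideal (lower_nilradical R) R"
proof -
  \<comment> \<open>Inserting the carrier keeps the family nonempty and gives the right value when
    there are no prime ideals.\<close>
  have "ideal (\<Inter>(insert (carrier R) {P. prime_ideal P R})) R"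
    using oneideal by (intro i_Intersect) (auto simp: prime_ideal_def)
  also have "\<Inter>(insert (carrier R) {P. prime_ideal P R}) = lower_nilradical R"
    unfolding lower_nilradical_def by auto
  finally show ?thesis .
qed

text \<open>When the nilpotent elements form an ideal, this is the hypothesis \<open>sq\<close> of
  \<open>quasinilpotent_subset_polys\<close> for that ideal. Both 2-primality and reducedness are
  fed into that lemma in this way.\<close>

lemma nilpotent_square:
  assumes "a \<in> carrier R" "a \<otimes> a \<in> nilpotent_elements R"
  shows "a \<in> nilpotent_elements R"
proof -
  obtain n :: nat where "n > 0" "(a \<otimes> a) [^] n = \<zero>"
    using assms(2) unfolding nilpotent_elements_def by blast
  moreover have "(a \<otimes> a) [^] n = a [^] (n + n)"
    using pow_mult_distrib[of a a n] nat_pow_mult[of a n n] assms(1) by simp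
  ultimately show ?thesis
    using assms(1) unfolding nilpotent_elements_def by auto
qed

end

lemma (in ideal) summand_mem:
  assumes "u \<in> carrier R" "v \<in> I" "u \<oplus> v \<in> I"
  shows "u \<in> I"
proof -
  have "u = (u \<oplus> v) \<oplus> \<ominus> v" using assms Icarr by (simp add: a_assoc r_neg)
  then show ?thesis
    using assms additive_subgroup.a_inv_closed[OF is_additive_subgroup, of v]
      additive_subgroup.a_closed[OF is_additive_subgroup, of "u \<oplus> v" "\<ominus> v"]
    by metis
qed

lemma (in ideal) finsum_mem:
  assumes "\<And>i. i \<in> A \<Longrightarrow> f i \<in> I"
  shows "finsum R f A \<in> I"
  using assms
proof (induction A rule: infinite_finite_induct)
  case (insert x F)
  then have "f \<in> F \<rightarrow> carrier R" "f x \<in> carrier R" using Icarr by auto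
  then show ?case using insert by simp
qed simp_all

section \<open>Polynomials with coefficients in an ideal, and contraction of prime ideals\<close>

context UP_ring
begin

lemma mem_polys_iff:
  "p \<in> polys_with_coeffs_in A R \<longleftrightarrow> p \<in> carrier P \<and> (\<forall>i. coeff P p i \<in> A)"
  unfolding polys_with_coeffs_in_def P_def by simp

lemma polys_with_coeffs_in_zero: "polys_with_coeffs_in {\<zero>} R = {\<zero>\<^bsub>P\<^esub>}"
  by (auto simp: mem_polys_iff intro!: up_eqI)

lemma ideal_polys_with_coeffs_in:
  assumes "ideal I R"
  shows "ideal (polys_with_coeffs_in I R) P"
proof -
  interpret I: ideal I R by fact
  show ?thesis
  proof (rule idealI[OF UP_ring])
    show "subgroup (polys_with_coeffs_in I R) (add_monoid P)"
    proof (rule P.add.subgroupI)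
      show "polys_with_coeffs_in I R \<noteq> {}"
        using mem_polys_iff[of "\<zero>\<^bsub>P\<^esub>" I] by auto
    qed (auto simp: mem_polys_iff)
    show "x \<otimes>\<^bsub>P\<^esub> a \<in> polys_with_coeffs_in I R" "a \<otimes>\<^bsub>P\<^esub> x \<in> polys_with_coeffs_in I R"
      if "a \<in> polys_with_coeffs_in I R" "x \<in> carrier P" for a x
      using that by (auto simp: mem_polys_iff I.I_l_closed I.I_r_closed intro!: I.finsum_mem)
  qed
qed

lemma monom_0_nat_pow:
  "a \<in> carrier R \<Longrightarrow> monom P a 0 [^]\<^bsub>P\<^esub> (n::nat) = monom P (a [^] n) 0"
  by (induction n) (simp_all flip: monom_mult)

lemma nilpotent_monom_0:
  "a \<in> nilpotent_elements R \<Longrightarrow> monom P a 0 \<in> nilpotent_elements P"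
  unfolding nilpotent_elements_def using monom_0_nat_pow by fastforce

text \<open>Each term of \<open>p\<close> is a constant from \<open>Q\<close> times a power of the
  indeterminate, so it is absorbed by \<open>Q\<close>, and \<open>p\<close> is the sum of its
  terms.\<close>

lemma poly_mem_ideal:
  assumes "ideal Q P" "p \<in> carrier P" "\<And>i. monom P (coeff P p i) 0 \<in> Q"
  shows "p \<in> Q"
proof -
  interpret Q: ideal Q P by fact
  have "monom P (coeff P p i) i \<in> Q" for i
    using Q.I_r_closed[OF assms(3)[of i], of "monom P \<one> i"] assms(2)
      monom_mult[of "coeff P p i" \<one> 0 i]
    by simp
  then have "finsum P (\<lambda>i. monom P (coeff P p i) i) {..deg R p} \<in> Q"
    by (intro Q.finsum_mem)
  then show ?thesis using up_repr[OF assms(2)] by simp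
qed

text \<open>If \<open>I J\<close> lies in the contraction of \<open>Q\<close>, then every
  coefficient of a product from \<open>I[x] J[x]\<close> is a sum of elements of \<open>I J\<close>,
  so \<open>I[x] J[x]\<close> lies in \<open>Q\<close>. Primeness of \<open>Q\<close> puts
  \<open>I[x]\<close> or \<open>J[x]\<close> inside \<open>Q\<close>, and restricting to constants
  gives the claim for \<open>I\<close> or \<open>J\<close>.\<close>

lemma prime_ideal_contract:
  assumes "prime_ideal Q P"
  shows "prime_ideal {a \<in> carrier R. monom P a 0 \<in> Q} R" (is "prime_ideal ?Q R")
proof -
  have idQ: "ideal Q P" and ne: "Q \<noteq> carrier P"
    and pr: "\<And>I J. ideal I P \<Longrightarrow> ideal J P \<Longrightarrow> ideal_prod P I J \<subseteq> Q \<Longrightarrow> I \<subseteq> Q \<or> J \<subseteq> Q"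
    using assms unfolding prime_ideal_def by auto
  interpret Q: ideal Q P by (rule idQ)
  have neg: "monom P (\<ominus> a) 0 = \<ominus>\<^bsub>P\<^esub> monom P a 0" if "a \<in> carrier R" for a
    using that by simp
  have mlt: "monom P (a \<otimes> b) 0 = monom P a 0 \<otimes>\<^bsub>P\<^esub> monom P b 0"
    if "a \<in> carrier R" "b \<in> carrier R" for a b
    using that monom_mult[of a b 0 0] by simp
  have idC: "ideal ?Q R"
  proof (rule idealI[OF R.ring_axioms])
    show "subgroup ?Q (add_monoid R)"
    proof (rule R.add.subgroupI)
      show "?Q \<noteq> {}"
        using Q.zero_closed monom_zero
        by (metis (mono_tags, lifting) R.zero_closed empty_iff mem_Collect_eq)
    qed (auto simp: neg)
  qed (auto simp: mlt Q.I_l_closed Q.I_r_closed)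
  have "\<one> \<notin> ?Q" using ne Q.one_imp_carrier by auto
  then have proper: "?Q \<noteq> carrier R" by blast
  have "I \<subseteq> ?Q \<or> J \<subseteq> ?Q" if IJ: "ideal I R" "ideal J R" "ideal_prod R I J \<subseteq> ?Q" for I J
  proof -
    have contr: "K \<subseteq> ?Q" if "ideal K R" "polys_with_coeffs_in K R \<subseteq> Q" for K
    proof
      interpret K: ideal K R by fact
      fix a assume "a \<in> K"
      then have "a \<in> carrier R" by (rule K.Icarr)
      moreover from this have "monom P a 0 \<in> polys_with_coeffs_in K R"
        using \<open>a \<in> K\<close> by (simp add: mem_polys_iff)
      then have "monom P a 0 \<in> Q" using that(2) by (rule rev_subsetD)
      ultimately show "a \<in> ?Q" by simp
    qed
    let ?I = "polys_with_coeffs_in I R" and ?J = "polys_with_coeffs_in J R"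
    interpret C: ideal ?Q R by (rule idC)
    have mult: "p \<otimes>\<^bsub>P\<^esub> q \<in> Q" if "p \<in> ?I" "q \<in> ?J" for p q
    proof (rule poly_mem_ideal[OF idQ])
      have co: "coeff P p i \<otimes> coeff P q j \<in> ?Q" for i j
      proof -
        have "coeff P p i \<otimes> coeff P q j \<in> ideal_prod R I J"
          using that by (intro ideal_prod.prod) (simp_all add: mem_polys_iff)
        then show ?thesis using IJ(3) by (rule rev_subsetD)
      qed
      have "coeff P (p \<otimes>\<^bsub>P\<^esub> q) n \<in> ?Q" for n
      proof -
        have "(\<Oplus>i\<in>{..n}. coeff P p i \<otimes> coeff P q (n - i)) \<in> ?Q"
          by (rule C.finsum_mem[OF co])
        then show ?thesis using that by (simp only: mem_polys_iff coeff_mult)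
      qed
      then show "monom P (coeff P (p \<otimes>\<^bsub>P\<^esub> q) n) 0 \<in> Q" for n by blast
    qed (use that in \<open>auto simp: mem_polys_iff\<close>)
    have "x \<in> Q" if "x \<in> ideal_prod P ?I ?J" for x
      using that by (induction rule: ideal_prod.induct) (auto intro: mult)
    then have "?I \<subseteq> Q \<or> ?J \<subseteq> Q"
      using pr ideal_polys_with_coeffs_in IJ by blast
    then show ?thesis using contr IJ(1,2) by meson
  qed
  then show ?thesis using idC proper unfolding prime_ideal_def by meson
qed

lemma polys_lower_nilradical_subset:
  "polys_with_coeffs_in (lower_nilradical R) R \<subseteq> lower_nilradical P"
proof
  fix p assume p: "p \<in> polys_with_coeffs_in (lower_nilradical R) R"
  have "p \<in> Q" if "prime_ideal Q P" for Q
  proof (rule poly_mem_ideal)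
    show "ideal Q P" using that unfolding prime_ideal_def by blast
    show "monom P (coeff P p i) 0 \<in> Q" for i
      using p prime_ideal_contract[OF that] unfolding mem_polys_iff lower_nilradical_def by blast
  qed (use p in \<open>auto simp: mem_polys_iff\<close>)
  then show "p \<in> lower_nilradical P"
    using p unfolding lower_nilradical_def by (auto simp: mem_polys_iff)
qed

text \<open>Multiplication by the indeterminate shifts coefficients. Since \<open>R\<close> may be
  noncommutative, the right and left versions are computed separately; comparing them yields
  \<open>X_comm\<close>.\<close>

lemma coeff_mult_X:
  assumes "p \<in> carrier P"
  shows "coeff P (p \<otimes>\<^bsub>P\<^esub> monom P \<one> 1) n = (case n of 0 \<Rightarrow> \<zero> | Suc k \<Rightarrow> coeff P p k)"
proof (cases n)
  case (Suc k)
  have "coeff P (p \<otimes>\<^bsub>P\<^esub> monom P \<one> 1) (Suc k)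
      = (\<Oplus>i\<in>{..Suc k}. if k = i then coeff P p i else \<zero>)"
    using assms by (auto intro!: R.finsum_cong' simp del: R.finsum_Suc)
  also have "\<dots> = coeff P p k"
    using assms by (intro R.finsum_singleton) auto
  finally show ?thesis using Suc by simp
qed (use assms in simp)

lemma coeff_X_mult:
  assumes "p \<in> carrier P"
  shows "coeff P (monom P \<one> 1 \<otimes>\<^bsub>P\<^esub> p) n = (case n of 0 \<Rightarrow> \<zero> | Suc k \<Rightarrow> coeff P p k)"
proof (cases n)
  case (Suc k)
  have "coeff P (monom P \<one> 1 \<otimes>\<^bsub>P\<^esub> p) (Suc k)
      = (\<Oplus>i\<in>{..Suc k}. if 1 = i then coeff P p (Suc k - i) else \<zero>)"
    using assms by (auto intro!: R.finsum_cong' simp del: R.finsum_Suc)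
  also have "\<dots> = coeff P p k"
    using assms R.finsum_singleton[of 1 "{..Suc k}" "\<lambda>i. coeff P p (Suc k - i)"] by auto
  finally show ?thesis using Suc by simp
qed (use assms in simp)

lemma X_comm: "p \<in> carrier P \<Longrightarrow> p \<otimes>\<^bsub>P\<^esub> monom P \<one> 1 = monom P \<one> 1 \<otimes>\<^bsub>P\<^esub> p"
  by (rule up_eqI) (simp_all only: coeff_mult_X coeff_X_mult UP_mult_closed monom_closed R.one_closed)

end

text \<open>A reduced quotient is encoded below by an ideal \<open>I\<close> such that \<open>a \<otimes> a \<in> I\<close> implies \<open>a \<in> I\<close>.\<close>

context ideal
begin

lemma semiprime_mult_swap:
  assumes sq: "\<And>a. a \<in> carrier R \<Longrightarrow> a \<otimes> a \<in> I \<Longrightarrow> a \<in> I"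
    and ab: "a \<in> carrier R" "b \<in> carrier R" "a \<otimes> b \<in> I"
  shows "b \<otimes> a \<in> I"
proof (rule sq)
  have "(b \<otimes> a) \<otimes> (b \<otimes> a) = b \<otimes> (a \<otimes> b) \<otimes> a"
    using ab by (simp add: m_assoc)
  then show "(b \<otimes> a) \<otimes> (b \<otimes> a) \<in> I"
    using ab I_l_closed I_r_closed by simp
qed (use ab in simp)

end

section \<open>Units and quasinilpotent polynomials modulo an ideal with reduced quotient\<close>

context UP_ring
begin

text \<open>A variant of the Armendariz property of reduced rings, taken modulo \<open>I\<close> and
  in positive degrees only. The induction runs downward on the total degree \<open>k\<close> and,
  for fixed \<open>k\<close>, upward on \<open>i\<close>. Multiplying the coefficient of degree
  \<open>k\<close> on the left by \<open>b_(k-i)\<close> leaves one term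
  \<open>b_(k-i) a_i b_(k-i)\<close> modulo \<open>I\<close>, which puts the square of
  \<open>a_i b_(k-i)\<close> into \<open>I\<close>.\<close>

lemma coeff_mult_mem_ideal:
  assumes "ideal I R"
    and sq: "\<And>a. a \<in> carrier R \<Longrightarrow> a \<otimes> a \<in> I \<Longrightarrow> a \<in> I"
    and pq: "p \<in> carrier P" "q \<in> carrier P" "\<And>k. k > 0 \<Longrightarrow> coeff P (p \<otimes>\<^bsub>P\<^esub> q) k \<in> I"
    and "i + j > 0"
  shows "coeff P p i \<otimes> coeff P q j \<in> I"
proof -
  interpret I: ideal I R by fact
  let ?a = "coeff P p" and ?b = "coeff P q"
  note swap = I.semiprime_mult_swap[OF sq]
  have car: "?a i \<in> carrier R" "?b i \<in> carrier R" for i using pq by simp_all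
  have "?a i \<otimes> ?b (k - i) \<in> I" if "k > 0" "i \<le> k" for k i
    using that
  \<comment> \<open>This measure encodes the downward induction on \<open>k\<close>. The
    \<open>Suc\<close> makes it drop strictly even at \<open>k = deg R p + deg R q\<close>; above
    that degree one of the two factors is zero.\<close>
  proof (induction "Suc (deg R p + deg R q) - k" arbitrary: k i rule: less_induct)
    case outer: less
    show ?case
      using \<open>i \<le> k\<close>
    proof (induction i rule: less_induct)
      case (less i)
      let ?j = "k - i" and ?t = "\<lambda>l. ?a l \<otimes> ?b (k - l)"
      show ?case
      proof (cases "k \<le> deg R p + deg R q")
        case False
        then have "i > deg R p \<or> ?j > deg R q" using less.prems by linarith
        then show ?thesis using pq car deg_aboveD by auto
      next
        case True
        \<comment> \<open>The pair \<open>l\<close>, \<open>?j\<close> has total degree above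
          \<open>k\<close>, so the outer hypothesis applies. The swap used in \<open>low\<close>
          then puts \<open>?b ?j\<close> in front.\<close>
        have high: "?a l \<otimes> ?b ?j \<in> I" if "l > i" for l
        proof -
          have "Suc (deg R p + deg R q) - (l + ?j) < Suc (deg R p + deg R q) - k" "l + ?j > 0"
            using True that less.prems by linarith+
          then show ?thesis using outer.hyps[of "l + ?j" l]
            by (simp only: add_diff_cancel_left' le_add1)
        qed
        have low: "?b ?j \<otimes> ?t l \<in> I" if l: "l \<in> {..k} - {i}" for l
        proof (cases "l < i")
          case True
          then show ?thesis using less l car I.I_l_closed by simp
        next
          case False
          then have "?b ?j \<otimes> ?a l \<in> I" using high swap l car by auto
          then have "?b ?j \<otimes> ?a l \<otimes> ?b (k - l) \<in> I" using car I.I_r_closed by blast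
          then show ?thesis using car by (simp add: R.m_assoc)
        qed
        have "coeff P (p \<otimes>\<^bsub>P\<^esub> q) k = ?t i \<oplus> finsum R ?t ({..k} - {i})"
        proof -
          have "finsum R ?t (insert i ({..k} - {i})) = ?t i \<oplus> finsum R ?t ({..k} - {i})"
            using car by (intro R.finsum_insert) auto
          then show ?thesis using pq less.prems by (simp add: insert_absorb)
        qed
        then have sum: "?b ?j \<otimes> coeff P (p \<otimes>\<^bsub>P\<^esub> q) k
            = ?b ?j \<otimes> ?t i \<oplus> finsum R (\<lambda>l. ?b ?j \<otimes> ?t l) ({..k} - {i})"
          using car by (simp add: R.r_distr R.finsum_rdistr Pi_def del: coeff_mult)
        \<comment> \<open>Left multiplication by \<open>?b ?j\<close> pushes the terms of first index above \<open>i\<close> into \<open>I\<close>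
          as well, since \<open>l + ?j > k\<close> there.\<close>
        have "?b ?j \<otimes> ?t i \<in> I"
        proof (rule I.summand_mem)
          show "finsum R (\<lambda>l. ?b ?j \<otimes> ?t l) ({..k} - {i}) \<in> I"
            using low by (rule I.finsum_mem)
          show "?b ?j \<otimes> ?t i \<oplus> finsum R (\<lambda>l. ?b ?j \<otimes> ?t l) ({..k} - {i}) \<in> I"
            unfolding sum[symmetric] using pq(3)[OF \<open>k > 0\<close>] car(2) by (rule I.I_l_closed)
        qed (use car in simp)
        then have "?a i \<otimes> (?b ?j \<otimes> ?t i) \<in> I" using car(1) by (rule I.I_l_closed)
        then have "?t i \<otimes> ?t i \<in> I" using car by (simp add: R.m_assoc)
        then show ?thesis using sq[of "?t i"] car by simp
      qed
    qed
  qed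
  from this[of "i + j" i] show ?thesis using assms(6) by simp
qed

text \<open>If \<open>q\<close> is the inverse, all coefficients of \<open>p q\<close> in positive
  degree are zero, so \<open>a_i b_0\<close> is in \<open>I\<close>. The normalisation
  \<open>a_0 = 1\<close> gives \<open>b_0 = 1\<close>, hence \<open>a_i\<close> itself is in
  \<open>I\<close>.\<close>

lemma unit_coeff_mem_ideal:
  assumes "ideal I R" and sq: "\<And>a. a \<in> carrier R \<Longrightarrow> a \<otimes> a \<in> I \<Longrightarrow> a \<in> I"
    and p: "p \<in> Units P" "coeff P p 0 = \<one>" and "i > 0"
  shows "coeff P p i \<in> I"
proof -
  obtain q where pc: "p \<in> carrier P" and q: "q \<in> carrier P" "p \<otimes>\<^bsub>P\<^esub> q = \<one>\<^bsub>P\<^esub>"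
    using p(1) unfolding Units_def by blast
  interpret I: ideal I R by fact
  have "coeff P p i \<otimes> coeff P q 0 \<in> I"
    using q \<open>i > 0\<close> by (intro coeff_mult_mem_ideal[OF assms(1) sq pc]) auto
  moreover have "coeff P q 0 = \<one>"
    using coeff_mult[OF pc q(1), of 0] q pc p(2) by simp
  ultimately show ?thesis using pc by simp
qed

lemma quasinilpotent_subset_polys:
  assumes "ideal I R" and sq: "\<And>a. a \<in> carrier R \<Longrightarrow> a \<otimes> a \<in> I \<Longrightarrow> a \<in> I"
  shows "quasinilpotent_elements P \<subseteq> polys_with_coeffs_in I R"
proof
  fix f assume f: "f \<in> quasinilpotent_elements P"
  interpret I: ideal I R by fact
  let ?h = "\<one>\<^bsub>P\<^esub> \<ominus>\<^bsub>P\<^esub> f \<otimes>\<^bsub>P\<^esub> monom P \<one> 1"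
  have fc: "f \<in> carrier P" using f unfolding quasinilpotent_elements_def by blast
  have h: "?h \<in> Units P"
    using f X_comm[OF fc] unfolding quasinilpotent_elements_def by simp
  \<comment> \<open>The shift moves every coefficient of \<open>f\<close>, including the constant
    one, to a positive degree of \<open>?h\<close>, where \<open>unit_coeff_mem_ideal\<close>
    reaches it.\<close>
  have coh: "coeff P ?h n = (if n = 0 then \<one> else \<ominus> coeff P f (n - 1))" for n
    using fc by (cases n) (simp_all add: P.minus_eq coeff_mult_X del: coeff_mult One_nat_def)
  have "coeff P f i \<in> I" for i
  proof -
    have "\<ominus> coeff P f i \<in> I"
      using unit_coeff_mem_ideal[OF assms h, of "Suc i"] coh by simp
    then have "\<ominus> (\<ominus> coeff P f i) \<in> I" by (rule I.a_inv_closed)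
    then show ?thesis using fc by simp
  qed
  then show "f \<in> polys_with_coeffs_in I R" using fc by (simp add: mem_polys_iff)
qed

section \<open>The two equivalences\<close>

lemma two_primal_iff:
  "two_primal R \<longleftrightarrow> quasinilpotent_elements P = polys_with_coeffs_in (lower_nilradical R) R"
proof
  assume R: "two_primal R"
  have "quasinilpotent_elements P \<subseteq> polys_with_coeffs_in (lower_nilradical R) R"
    using R.nilpotent_square R unfolding two_primal_def
    by (metis quasinilpotent_subset_polys[OF R.ideal_lower_nilradical])
  moreover have "polys_with_coeffs_in (lower_nilradical R) R \<subseteq> nilpotent_elements P"
    using polys_lower_nilradical_subset P.lower_nilradical_subset_nilpotent by blast
  ultimately show "quasinilpotent_elements P = polys_with_coeffs_in (lower_nilradical R) R"
    using P.nil_ideal_subset_quasinilpotent ideal_polys_with_coeffs_in R.ideal_lower_nilradical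
    by blast
next
  assume eq: "quasinilpotent_elements P = polys_with_coeffs_in (lower_nilradical R) R"
  \<comment> \<open>A nilpotent \<open>a\<close> gives a nilpotent, hence quasinilpotent, constant
    polynomial; its coefficient at 0 is \<open>a\<close>, so \<open>eq\<close> applies to it. The
    reverse inclusion holds in every ring.\<close>
  have "a \<in> lower_nilradical R" if a: "a \<in> nilpotent_elements R" for a
  proof -
    have "a \<in> carrier R" using a unfolding nilpotent_elements_def by blast
    moreover have "monom P a 0 \<in> polys_with_coeffs_in (lower_nilradical R) R"
      using nilpotent_monom_0[OF a] P.nilpotent_subset_quasinilpotent eq by blast
    ultimately show ?thesis unfolding mem_polys_iff by (metis coeff_monom)
  qed
  then show "two_primal R"
    using R.lower_nilradical_subset_nilpotent unfolding two_primal_def by blast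
qed

text \<open>The same argument with the zero ideal in place of the lower nilradical: the polynomials
  with all coefficients in it form the zero ideal.\<close>

lemma reduced_ring_iff: "reduced_ring R \<longleftrightarrow> quasinilpotent_elements P = {\<zero>\<^bsub>P\<^esub>}"
proof
  have zero: "\<zero>\<^bsub>P\<^esub> \<in> quasinilpotent_elements P"
    unfolding quasinilpotent_elements_def by (auto simp: P.minus_eq)
  assume "reduced_ring R"
  then have "quasinilpotent_elements P \<subseteq> polys_with_coeffs_in {\<zero>} R"
    using R.nilpotent_square unfolding reduced_ring_def
    by (metis quasinilpotent_subset_polys[OF R.zeroideal])
  then show "quasinilpotent_elements P = {\<zero>\<^bsub>P\<^esub>}"
    using zero by (auto simp: polys_with_coeffs_in_zero)
next
  assume eq: "quasinilpotent_elements P = {\<zero>\<^bsub>P\<^esub>}"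
  have "a = \<zero>" if a: "a \<in> nilpotent_elements R" for a
  proof -
    have "a \<in> carrier R" using a unfolding nilpotent_elements_def by blast
    moreover have "monom P a 0 = \<zero>\<^bsub>P\<^esub>"
      using nilpotent_monom_0[OF a] P.nilpotent_subset_quasinilpotent eq by blast
    ultimately show ?thesis by (metis coeff_monom coeff_zero)
  qed
  moreover have "\<zero> \<in> nilpotent_elements R"
    unfolding nilpotent_elements_def by (auto intro!: exI[of _ 1])
  ultimately show "reduced_ring R" unfolding reduced_ring_def by blast
qed

end

theorem theorem3p1:
  fixes R :: "('a, 'b) ring_scheme"
  assumes "ring R"
  shows "(two_primal R \<longleftrightarrow>
            quasinilpotent_elements (UP R) = polys_with_coeffs_in (lower_nilradical R) R) \<and>
         (reduced_ring R \<longleftrightarrow> quasinilpotent_elements (UP R) = {\<zero>\<^bsub>UP R\<^esub>})"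
proof -
  interpret UP_ring R "UP R" by (intro UP_ring.intro assms)
  show ?thesis using two_primal_iff reduced_ring_iff by blast
qed

end
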